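(* For every integer $r\geq 2$ there exists $m_0=m_0(r)$ such that if $H$ is a connected graph with $m\geq m_0$ edges and $H$ is not a star, then $\widehat{R}_r(H)> \frac{r^2}{72}m$.
   Context: Graphs are finite and simple. The $r$-color size-Ramsey number $\widehat{R}_r(H)$ of a graph $H$ is the minimum number of edges in a graph $G$ having the property that every $r$-coloring of the edges of $G$ contains a monochromatic copy of $H$ (as a not necessarily induced subgraph). A star is a graph of the form $K_{1,k}$. *)

theory Defs
  imports Complex_Main "HOL-Library.Ramsey"
begin

record 'a sgraph =
  verts :: "'a set"
  edges :: "'a set set"

definition simple_graph :: "'a sgraph \<Rightarrow> bool" where
  "simple_graph G \<longleftrightarrow> finite (verts G) \<and> edges G \<subseteq> [verts G]\<^bsup>2\<^esup>"

definition subgraph :: "'a sgraph \<Rightarrow> 'a sgraph \<Rightarrow> bool" where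
  "subgraph K G \<longleftrightarrow> simple_graph K \<and> simple_graph G \<and> verts K \<subseteq> verts G \<and> edges K \<subseteq> edges G"

definition isomorphic :: "'a sgraph \<Rightarrow> 'b sgraph \<Rightarrow> bool" where
  "isomorphic G H \<longleftrightarrow>
     (\<exists>f. bij_betw f (verts G) (verts H) \<and> edges H = (\<lambda>e. f ` e) ` edges G)"

definition connected_graph :: "'a sgraph \<Rightarrow> bool" where
  "connected_graph G \<longleftrightarrow> verts G \<noteq> {} \<and>
     (\<forall>u\<in>verts G. \<forall>v\<in>verts G. (u, v) \<in> {(x, y). {x, y} \<in> edges G}\<^sup>*)"

text \<open>The graph \<open>K\<^sub>1\<^sub>,\<^sub>k\<close>, with centre \<open>0\<close> and leaves \<open>1, \<dots>, k\<close>.\<close>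

definition star_graph :: "nat \<Rightarrow> nat sgraph" where
  "star_graph k = \<lparr>verts = {0..k}, edges = {{0, i} |i. i \<in> {1..k}}\<rparr>"

definition is_star :: "'a sgraph \<Rightarrow> bool" where
  "is_star G \<longleftrightarrow> (\<exists>k\<ge>1. isomorphic G (star_graph k))"

text \<open>Edge colourings are arbitrary maps from edges to \<open>{0, \<dots>, r - 1}\<close>, not necessarily proper.\<close>

definition ramsey_for :: "nat \<Rightarrow> 'a sgraph \<Rightarrow> 'b sgraph \<Rightarrow> bool" where
  "ramsey_for r G H \<longleftrightarrow>
     (\<forall>c \<in> edges G \<rightarrow> {..<r}.
        \<exists>K. subgraph K G \<and> isomorphic H K \<and> (\<exists>i<r. \<forall>e\<in>edges K. c e = i))"

text \<open>Host graphs are taken on vertex sets in \<^typ>\<open>nat\<close>, which represents every finite graph up to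
  isomorphism. For \<open>r \<ge> 1\<close> and simple \<open>H\<close> the minimum is over a nonempty set by Ramsey's theorem.\<close>

definition size_ramsey :: "nat \<Rightarrow> 'a sgraph \<Rightarrow> nat" where
  "size_ramsey r H =
     (LEAST n. \<exists>G :: nat sgraph. simple_graph G \<and> card (edges G) = n \<and> ramsey_for r G H)"

end

theory Submission
  imports Defs "HOL-Algebra.Algebraic_Closure_Type" "HOL-Library.Z2"
begin

text \<open>Let \<open>G\<close> have \<open>e \<le> r\<^sup>2 m / 72\<close> edges and let \<open>q\<close> be the power of two with \<open>r / 4 < q \<le> r / 2\<close>.
  Fewer than \<open>r - q\<close> vertices have degree larger than \<open>D = 2 e / (r - q)\<close>; each of them gets a private
  colour for its edges, so that the components of these colours are stars. The other vertices are mapped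
  to the points of the affine plane of order \<open>q\<close>, and an edge between two of them is coloured by the
  parallel class of a line through both images. A monochromatic connected subgraph is then mapped into
  a single line, and it suffices that fewer than \<open>m\<close> edges go into each line.

  To achieve this, split the vertices of degree larger than \<open>\<eta> = m / r\<^sup>4\<close> into \<open>q\<close> classes of nearly
  equal degree sum and map the classes to the points of a parabola, of which a line contains at most two.
  The remaining vertices are mapped at random: the expected number of edges in a line is at most
  \<open>2 e / q\<^sup>2 + 2 D / q\<close>, and two edges are correlated only if they share a randomly placed vertex, so
  that Chebyshev's inequality applies. Edges between vertices of degree larger than \<open>\<eta>\<close> are bounded in
  number by a function of \<open>r\<close>.\<close>

subsection \<open>An affine plane of order \<open>2\<^sup>k\<close>\<close>

lemma CHAR_bit_alg_closure: "CHAR(bit alg_closure) = 2"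
proof -
  have "even n" if "(of_nat n :: bit) = 0" for n
    using that by (cases "even n") (auto elim!: oddE)
  then have "CHAR(bit) = 2"
    by (intro CHAR_eqI) auto
  then show ?thesis by simp
qed

text \<open>The set consists of the roots of X^(2^k) - X, which splits over an algebraically closed
  field. In characteristic 2 its derivative is the constant -1, so no root is repeated and the roots
  are as many as the degree.\<close>

lemma card_pow2_field:
  assumes "k \<ge> 1"
  shows "finite {x::bit alg_closure. x ^ 2 ^ k = x}"
    and "card {x::bit alg_closure. x ^ 2 ^ k = x} = 2 ^ k"
proof -
  define p :: "bit alg_closure poly" where "p = [:0, -1:] + monom 1 (2^k)"
  have lt: "degree ([:0, -1:] :: bit alg_closure poly) < degree (monom (1::bit alg_closure) (2^k))"
    using one_less_power[of "2::nat" k] assms by (simp add: degree_monom_eq)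
  have deg: "degree p = 2 ^ k"
    unfolding p_def by (subst degree_add_eq_right) (use lt in \<open>auto simp: degree_monom_eq\<close>)
  have lc: "lead_coeff p = 1"
    unfolding p_def lead_coeff_add_le[OF lt] by (simp only: lead_coeff_monom)
  have "p \<noteq> 0" using lc by auto
  have two: "(of_nat 2 :: bit alg_closure) = 0"
    using of_nat_CHAR[where ?'a = "bit alg_closure"] unfolding CHAR_bit_alg_closure .
  have "(of_nat (2 ^ k) :: bit alg_closure) = 0"
    using assms two by (cases k) auto
  then have der: "pderiv p = [:-1:]"
    by (simp add: p_def pderiv_add pderiv_monom pderiv_pCons)
  have poly: "poly p x = x ^ 2 ^ k - x" for x
    by (simp add: p_def poly_monom)
  obtain A where A: "size A = degree p" "p = smult (lead_coeff p) (\<Prod>x\<in>#A. [:-x, 1:])"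
    using alg_closed_imp_factorization[OF \<open>p \<noteq> 0\<close>] by blast
  have pA: "p = (\<Prod>x\<in>#A. [:-x, 1:])" using A(2) lc by simp
  have roots: "{x. x ^ 2 ^ k = x} = set_mset A"
  proof -
    have "poly p x = 0 \<longleftrightarrow> x \<in># A" for x
      unfolding pA by (induction A) (auto)
    then show ?thesis unfolding poly by auto
  qed
  have "count A x = 1" if "x \<in># A" for x
  proof (rule ccontr)
    assume "count A x \<noteq> 1"
    obtain B where B: "A = add_mset x B" using multi_member_split[OF \<open>x \<in># A\<close>] by blast
    with \<open>count A x \<noteq> 1\<close> have xB: "x \<in># B" using count_eq_zero_iff[of B x] by force
    obtain C where C: "B = add_mset x C" using multi_member_split[OF xB] by blast
    have pC: "p = [:-x, 1:] * ([:-x, 1:] * (\<Prod>x\<in>#C. [:-x, 1:]))"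
      unfolding pA B C by (simp only: image_mset_add_mset prod_mset.add_mset)
    have "poly (pderiv p) x = 0"
      unfolding pC pderiv_mult poly_add poly_mult by simp
    then show False by (simp add: der)
  qed
  then have "size A = (\<Sum>x\<in>set_mset A. 1)"
    unfolding size_multiset_overloaded_eq by (intro sum.cong) auto
  then have "size A = card (set_mset A)" by simp
  then show "card {x::bit alg_closure. x ^ 2 ^ k = x} = 2 ^ k"
    using roots A(1) deg by simp
  show "finite {x::bit alg_closure. x ^ 2 ^ k = x}" unfolding roots by simp
qed

text \<open>Additivity of the Frobenius power, applied to the sum \<open>x - y + y\<close>, gives
  subtraction without any discussion of signs.\<close>

lemma pow2_field_diff:
  fixes x y :: "bit alg_closure"
  assumes "x ^ 2 ^ k = x" "y ^ 2 ^ k = y"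
  shows "(x - y) ^ 2 ^ k = x - y"
proof -
  have "(x - y + y) ^ 2 ^ k = (x - y) ^ 2 ^ k + y ^ 2 ^ k"
    by (rule freshmans_dream'[where n = k]) (simp_all only: CHAR_bit_alg_closure two_is_prime_nat)
  then show ?thesis using assms by (metis add_diff_cancel_right' diff_add_cancel)
qed

text \<open>The colours \<open>c \<le> q\<close> are the parallel classes of an affine plane of order \<open>q\<close> with point set \<open>P\<close>;
  \<open>\<phi> c p\<close> names the line of class \<open>c\<close> through \<open>p\<close>, and \<open>C\<close> is the point set of a parabola.\<close>

locale conic_plane =
  fixes q :: nat and P :: "'p set" and K :: "'k set" and \<phi> :: "nat \<Rightarrow> 'p \<Rightarrow> 'k" and C :: "'p set"
  assumes q: "q \<ge> 1"
    and finite_P: "finite P" and card_P: "card P = q\<^sup>2"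
    and finite_K: "finite K" and card_K: "card K = q"
    and \<phi>_K: "c \<le> q \<Longrightarrow> p \<in> P \<Longrightarrow> \<phi> c p \<in> K"
    and joined: "p \<in> P \<Longrightarrow> p' \<in> P \<Longrightarrow> \<exists>c\<le>q. \<phi> c p = \<phi> c p'"
    and card_line: "c \<le> q \<Longrightarrow> card {p \<in> P. \<phi> c p = k} \<le> q"
    and C_P: "C \<subseteq> P" and card_C: "card C = q"
    and card_line_C: "c \<le> q \<Longrightarrow> card {p \<in> C. \<phi> c p = k} \<le> 2"

text \<open>The plane is the usual coordinate plane over \<open>S\<close>. Two points with different
  first coordinates are joined by the line whose slope is their difference quotient. The parabola
  meets a line of given slope in the roots of a monic quadratic and a vertical line in at most one
  point.\<close>

lemma conic_plane_over_subfield: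
  fixes S :: "'k::field set"
  assumes fin: "finite S" and q: "card S = q" "q \<ge> 1"
    and diff: "\<And>x y. x \<in> S \<Longrightarrow> y \<in> S \<Longrightarrow> x - y \<in> S"
    and mult: "\<And>x y. x \<in> S \<Longrightarrow> y \<in> S \<Longrightarrow> x * y \<in> S"
    and inv: "\<And>x. x \<in> S \<Longrightarrow> inverse x \<in> S"
  shows "\<exists>(\<phi> :: nat \<Rightarrow> 'k \<times> 'k \<Rightarrow> 'k) C. conic_plane q (S \<times> S) S \<phi> C"
proof -
  obtain s where s: "bij_betw s {0..<q} S"
    using ex_bij_betw_nat_finite[OF fin] q by blast
  \<comment> \<open>Class \<open>c < q\<close> consists of the lines of slope \<open>s c\<close>, class \<open>q\<close> of the vertical ones.\<close>
  define \<phi> where "\<phi> c p = (if c < q then snd p - s c * fst p else fst p)" for c :: nat and p :: "'k \<times> 'k"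
  define C where "C = (\<lambda>x. (x, x * x)) ` S"
  have sS: "s c \<in> S" if "c < q" for c using s that by (auto simp: bij_betw_def)
  have line: "card {p \<in> S \<times> S. \<phi> c p = k} \<le> q" for c k
  proof (cases "c < q")
    case True
    have "inj_on fst {p \<in> S \<times> S. \<phi> c p = k}"
      using True by (auto simp: inj_on_def \<phi>_def)
    then have "card {p \<in> S \<times> S. \<phi> c p = k} \<le> card S"
      by (rule card_inj_on_le) (use fin in auto)
    then show ?thesis using q by simp
  next
    case False
    have "inj_on snd {p \<in> S \<times> S. \<phi> c p = k}"
      using False by (auto simp: inj_on_def \<phi>_def)
    then have "card {p \<in> S \<times> S. \<phi> c p = k} \<le> card S"
      by (rule card_inj_on_le) (use fin in auto)
    then show ?thesis using q by simp
  qed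
  have conic: "card {p \<in> C. \<phi> c p = k} \<le> 2" for c k
  proof (cases "c < q")
    case True
    \<comment> \<open>The point (x, x * x) lies on the line of slope \<open>s c\<close> and
      intercept \<open>k\<close> exactly if x is a root of this polynomial.\<close>
    define f where "f = [:-k, - s c, 1:]"
    have "{p \<in> C. \<phi> c p = k} \<subseteq> (\<lambda>x. (x, x * x)) ` {x. poly f x = 0}"
      using True by (auto simp: C_def \<phi>_def f_def algebra_simps)
    moreover have f: "f \<noteq> 0" "degree f = 2" by (auto simp: f_def)
    ultimately have "card {p \<in> C. \<phi> c p = k} \<le> card {x. poly f x = 0}"
      using surj_card_le[OF poly_roots_finite[OF f(1)]] by blast
    also have "\<dots> \<le> 2" using card_poly_roots_bound[OF f(1)] f(2) by simp
    finally show ?thesis .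
  next
    case False
    then have "{p \<in> C. \<phi> c p = k} \<subseteq> {(k, k * k)}"
      by (auto simp: C_def \<phi>_def)
    then have "card {p \<in> C. \<phi> c p = k} \<le> 1"
      using card_mono[of "{(k, k * k)}"] by simp
    then show ?thesis by simp
  qed
  have joined: "\<exists>c\<le>q. \<phi> c p = \<phi> c p'" if "p \<in> S \<times> S" "p' \<in> S \<times> S" for p p'
  proof (cases "fst p = fst p'")
    case True
    then show ?thesis by (intro exI[of _ q]) (auto simp: \<phi>_def)
  next
    case False
    have "(snd p - snd p') * inverse (fst p - fst p') \<in> S"
      using that by (intro mult diff inv) auto
    then obtain c where c: "c < q" "s c = (snd p - snd p') * inverse (fst p - fst p')"
      using s unfolding bij_betw_def by (metis atLeastLessThan_iff imageE)
    then have "s c * (fst p - fst p') = snd p - snd p'"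
      using False by simp
    then have "\<phi> c p = \<phi> c p'"
      using c(1) by (simp add: \<phi>_def algebra_simps)
    then show ?thesis using c(1) less_imp_le by blast
  qed
  have "conic_plane q (S \<times> S) S \<phi> C"
  proof
    show "card C = q" unfolding C_def using q by (subst card_image) (auto simp: inj_on_def)
    show "C \<subseteq> S \<times> S" using mult by (auto simp: C_def)
    show "\<phi> c p \<in> S" if "c \<le> q" "p \<in> S \<times> S" for c p
      using that by (auto simp: \<phi>_def intro!: diff mult sS)
  qed (use fin q line conic joined in \<open>auto simp: card_cartesian_product power2_eq_square\<close>)
  then show ?thesis by blast
qed

text \<open>The coordinates are the fixed points of the k-th Frobenius power. Orders that are powers
  of two suffice, because one of them lies between r / 4 and r / 2.\<close>

lemma ex_conic_plane:
  assumes "k \<ge> 1"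
  shows "\<exists>P K (\<phi> :: nat \<Rightarrow> bit alg_closure \<times> bit alg_closure \<Rightarrow> bit alg_closure) C.
           conic_plane (2 ^ k) P K \<phi> C"
proof -
  let ?S = "{x::bit alg_closure. x ^ 2 ^ k = x}"
  have "\<exists>(\<phi> :: nat \<Rightarrow> bit alg_closure \<times> bit alg_closure \<Rightarrow> bit alg_closure) C.
          conic_plane (2 ^ k) (?S \<times> ?S) ?S \<phi> C"
  proof (rule conic_plane_over_subfield)
    show "finite ?S" "card ?S = 2 ^ k" using card_pow2_field[OF assms] by blast+
    show "x - y \<in> ?S" if "x \<in> ?S" "y \<in> ?S" for x y
      using that pow2_field_diff by blast
    show "x * y \<in> ?S" if "x \<in> ?S" "y \<in> ?S" for x y
      using that by (simp only: mem_Collect_eq power_mult_distrib)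
    show "inverse x \<in> ?S" if "x \<in> ?S" for x
      using that by (simp only: mem_Collect_eq power_inverse)
  qed simp
  then show ?thesis by blast
qed

subsection \<open>Balanced and random placements\<close>

lemma balanced_partition:
  fixes w :: "'a \<Rightarrow> real"
  assumes "finite A" "finite S" "S \<noteq> {}" "\<And>a. a \<in> A \<Longrightarrow> 0 \<le> w a \<and> w a \<le> D" "0 \<le> D"
  shows "\<exists>h \<in> A \<rightarrow> S. \<forall>s\<in>S. sum w {a\<in>A. h a = s} \<le> sum w A / card S + D"
  using assms(1,4)
proof (induction A)
  case empty
  then show ?case using \<open>0 \<le> D\<close> \<open>S \<noteq> {}\<close> by (auto intro!: exI[of _ "\<lambda>_. SOME s. s \<in> S"] simp: some_in_eq)
next
  case (insert a A)
  then obtain h where h: "h \<in> A \<rightarrow> S"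
    and le: "\<And>s. s \<in> S \<Longrightarrow> sum w {x\<in>A. h x = s} \<le> sum w A / card S + D" by blast
  have cS: "card S > 0" using assms by (simp add: card_gt_0_iff)
  have w: "0 \<le> w a" "w a \<le> D" using insert.prems by auto
  \<comment> \<open>Greedy step: \<open>a\<close> joins a block of at most average weight.\<close>
  have "\<exists>t\<in>S. sum w {x\<in>A. h x = t} \<le> sum w A / card S"
  proof (rule ccontr)
    assume "\<not> ?thesis"
    then have "(\<Sum>t\<in>S. sum w A / card S) < (\<Sum>t\<in>S. sum w {x\<in>A. h x = t})"
      using assms(2,3) by (intro sum_strict_mono) auto
    also have "\<dots> = sum w A"
      using h insert.hyps(1) assms(2) by (intro sum.group) auto
    finally show False using cS by simp
  qed
  then obtain t where t: "t \<in> S" "sum w {x\<in>A. h x = t} \<le> sum w A / card S" by blast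
  let ?h = "h(a := t)"
  have "sum w {x\<in>insert a A. ?h x = s} \<le> sum w (insert a A) / card S + D" if s: "s \<in> S" for s
  proof -
    \<comment> \<open>Since weights are nonnegative, the average only grows, so the blocks that
      \<open>a\<close> does not join keep their bound.\<close>
    have mono: "sum w A / card S \<le> sum w (insert a A) / card S"
      using insert.hyps w by (simp add: divide_right_mono)
    show ?thesis
    proof (cases "s = t")
      case True
      have "{x\<in>insert a A. ?h x = s} = insert a {x\<in>A. h x = t}"
        using insert.hyps True by auto
      then show ?thesis using insert.hyps t w mono by simp
    next
      case False
      have "{x\<in>insert a A. ?h x = s} = {x\<in>A. h x = s}"
        using insert.hyps False by auto
      then show ?thesis using le[OF s] mono by simp
    qed
  qed
  moreover have "?h \<in> insert a A \<rightarrow> S" using h t by auto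
  ultimately show ?case by blast
qed

text \<open>This is independence in counting form: under the uniform distribution on maps from
  \<open>B\<close> to \<open>P\<close>, each point of \<open>T\<close> lands in \<open>L\<close>
  with probability |L| / |P|, independently of the others. Extensional functions make the sample
  space finite.\<close>

lemma card_PiE_constrained:
  assumes "finite B" "T \<subseteq> B" "finite P" "P \<noteq> {}" "L \<subseteq> P"
  shows "real (card {g \<in> B \<rightarrow>\<^sub>E P. g ` T \<subseteq> L})
       = real (card (B \<rightarrow>\<^sub>E P)) * (real (card L) / real (card P)) ^ card T"
proof -
  have fT: "finite T" using assms finite_subset by blast
  have cP: "card P \<noteq> 0" using assms by auto
  have "{g \<in> B \<rightarrow>\<^sub>E P. g ` T \<subseteq> L} = (\<Pi>\<^sub>E i\<in>B. if i \<in> T then L else P)"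
    using assms(2,5) by (fastforce simp: PiE_iff split: if_splits)
  then have "card {g \<in> B \<rightarrow>\<^sub>E P. g ` T \<subseteq> L} = (\<Prod>i\<in>B. if i \<in> T then card L else card P)"
    using assms(1) by (simp add: card_PiE if_distrib)
  also have "\<dots> = card L ^ card T * card P ^ card (B - T)"
    using assms(1,2) by (simp add: prod.If_cases Int_absorb1 Diff_eq)
  moreover have "card (B \<rightarrow>\<^sub>E P) = card P ^ card T * card P ^ card (B - T)"
    using assms fT by (simp add: card_PiE card_Diff_subset card_mono flip: power_add)
  ultimately show ?thesis using cP by (simp add: power_divide)
qed

text \<open>The variance is a sum of covariances over pairs of elements of \<open>F\<close>. If
  \<open>T e\<close> and \<open>T f\<close> are disjoint, the two events are independent and
  contribute nothing; any other pair contributes at most 1.\<close>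

lemma second_moment:
  fixes T :: "'e \<Rightarrow> 'b set" and P L :: "'p set"
  assumes "finite B" "finite F" "\<And>e. e \<in> F \<Longrightarrow> T e \<subseteq> B" "finite P" "P \<noteq> {}" "L \<subseteq> P"
  defines "\<rho> \<equiv> real (card L) / real (card P)"
  shows "(\<Sum>g\<in>B \<rightarrow>\<^sub>E P. (real (card {e\<in>F. g ` T e \<subseteq> L}) - (\<Sum>e\<in>F. \<rho> ^ card (T e)))\<^sup>2)
       \<le> real (card (B \<rightarrow>\<^sub>E P)) * real (card {(e, f) \<in> F \<times> F. T e \<inter> T f \<noteq> {}})"
proof -
  let ?\<Omega> = "B \<rightarrow>\<^sub>E P" and ?\<mu> = "\<Sum>e\<in>F. \<rho> ^ card (T e)"
  let ?X = "\<lambda>g. real (card {e\<in>F. g ` T e \<subseteq> L})"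
  let ?N = "real (card ?\<Omega>)"
  have fin\<Omega>: "finite ?\<Omega>" using assms by (intro finite_PiE) auto
  have \<rho>: "0 \<le> \<rho>" "\<rho> \<le> 1" using card_mono[OF assms(4,6)] by (auto simp: \<rho>_def divide_le_eq_1)
  have X: "?X g = (\<Sum>e\<in>F. of_bool (g ` T e \<subseteq> L))" for g
    using assms(2) by (simp add: sum_of_bool_eq Int_def)
  have count: "(\<Sum>g\<in>?\<Omega>. of_bool (g ` U \<subseteq> L)) = ?N * \<rho> ^ card U" if "U \<subseteq> B" for U
    using card_PiE_constrained[OF assms(1) that assms(4,5,6)] fin\<Omega>
    by (simp add: sum_of_bool_eq Int_def \<rho>_def)
  have "(\<Sum>g\<in>?\<Omega>. ?X g) = (\<Sum>e\<in>F. \<Sum>g\<in>?\<Omega>. of_bool (g ` T e \<subseteq> L))"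
    unfolding X by (rule sum.swap)
  also have "\<dots> = ?N * ?\<mu>"
    using assms(3) by (simp add: count sum_distrib_left)
  finally have first: "(\<Sum>g\<in>?\<Omega>. ?X g) = ?N * ?\<mu>" .
  \<comment> \<open>The product of the indicators for \<open>T e\<close> and \<open>T f\<close> is
    the indicator for their union, so the square counts pairs.\<close>
  have "(\<Sum>g\<in>?\<Omega>. (?X g)\<^sup>2) = (\<Sum>g\<in>?\<Omega>. \<Sum>(e, f)\<in>F \<times> F. of_bool (g ` (T e \<union> T f) \<subseteq> L))"
    unfolding X power2_eq_square sum_product
    by (simp add: sum.cartesian_product image_Un flip: of_bool_conj)
  also have "\<dots> = (\<Sum>(e, f)\<in>F \<times> F. \<Sum>g\<in>?\<Omega>. of_bool (g ` (T e \<union> T f) \<subseteq> L))"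
    by (subst sum.swap) (simp add: case_prod_unfold)
  also have "\<dots> = (\<Sum>(e, f)\<in>F \<times> F. ?N * \<rho> ^ card (T e \<union> T f))"
    by (intro sum.cong refl) (use assms(3) count in auto)
  also have "\<dots> \<le> (\<Sum>(e, f)\<in>F \<times> F. ?N * (\<rho> ^ card (T e) * \<rho> ^ card (T f) + of_bool (T e \<inter> T f \<noteq> {})))"
  proof (intro sum_mono, clarify)
    fix e f assume ef: "e \<in> F" "f \<in> F"
    have "\<rho> ^ card (T e \<union> T f) \<le> \<rho> ^ card (T e) * \<rho> ^ card (T f) + of_bool (T e \<inter> T f \<noteq> {})"
    proof (cases "T e \<inter> T f = {}")
      case True
      moreover have "finite (T e)" "finite (T f)" using ef assms(1,3) finite_subset by blast+
      ultimately show ?thesis by (simp add: card_Un_disjoint power_add)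
    next
      case False
      then show ?thesis using \<rho> by (simp add: power_le_one add_increasing)
    qed
    then show "?N * \<rho> ^ card (T e \<union> T f) \<le> ?N * (\<rho> ^ card (T e) * \<rho> ^ card (T f) + of_bool (T e \<inter> T f \<noteq> {}))"
      by (intro mult_left_mono) auto
  qed
  also have "\<dots> = ?N * ?\<mu>\<^sup>2 + ?N * real (card {(e, f) \<in> F \<times> F. T e \<inter> T f \<noteq> {}})"
  proof -
    have "(\<Sum>(e, f)\<in>F \<times> F. \<rho> ^ card (T e) * \<rho> ^ card (T f)) = ?\<mu>\<^sup>2"
      by (simp add: power2_eq_square sum_product sum.cartesian_product)
    moreover have "(\<Sum>(e, f)\<in>F \<times> F. of_bool (T e \<inter> T f \<noteq> {})) = real (card {(e, f) \<in> F \<times> F. T e \<inter> T f \<noteq> {}})"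
    proof -
      have "{(e, f) \<in> F \<times> F. T e \<inter> T f \<noteq> {}} = F \<times> F \<inter> {(e, f). T e \<inter> T f \<noteq> {}}" by auto
      then show ?thesis
        using assms(2) sum_of_bool_eq[of "F \<times> F" "\<lambda>(e, f). T e \<inter> T f \<noteq> {}", where ?'a = real]
        by (simp add: case_prod_unfold)
    qed
    ultimately show ?thesis
      by (simp add: case_prod_unfold sum.distrib distrib_left flip: sum_distrib_left)
  qed
  finally have second: "(\<Sum>g\<in>?\<Omega>. (?X g)\<^sup>2) \<le> ?N * ?\<mu>\<^sup>2 + ?N * real (card {(e, f) \<in> F \<times> F. T e \<inter> T f \<noteq> {}})" .
  have "(\<Sum>g\<in>?\<Omega>. (x g - a)\<^sup>2) = (\<Sum>g\<in>?\<Omega>. (x g)\<^sup>2) - 2 * a * (\<Sum>g\<in>?\<Omega>. x g) + ?N * a\<^sup>2"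
    for x :: "('b \<Rightarrow> 'p) \<Rightarrow> real" and a
    by (simp add: power2_diff sum.distrib sum_subtractf sum_distrib_left mult_ac)
  from this[of ?X ?\<mu>]
  have "(\<Sum>g\<in>?\<Omega>. (?X g - ?\<mu>)\<^sup>2) = (\<Sum>g\<in>?\<Omega>. (?X g)\<^sup>2) - 2 * ?\<mu> * (\<Sum>g\<in>?\<Omega>. ?X g) + ?N * ?\<mu>\<^sup>2" .
  also have "\<dots> = (\<Sum>g\<in>?\<Omega>. (?X g)\<^sup>2) - ?N * ?\<mu>\<^sup>2"
    unfolding first by (simp add: power2_eq_square)
  finally show ?thesis using second by simp
qed

text \<open>Chebyshev's inequality with a union bound: if every \<open>g\<close> exceeded some mean
  by more than \<open>d\<close>, each would contribute at least the square of \<open>d\<close> to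
  the total of all squared deviations, which is too small for that.\<close>

lemma ex_small_deviations:
  fixes f :: "'l \<Rightarrow> 'g \<Rightarrow> real" and d R :: real
  assumes "finite \<Omega>" "\<Omega> \<noteq> {}" "finite \<Lambda>" "0 \<le> d"
    and "\<And>l. l \<in> \<Lambda> \<Longrightarrow> (\<Sum>g\<in>\<Omega>. (f l g - \<mu> l)\<^sup>2) \<le> card \<Omega> * R"
    and "card \<Lambda> * R < d\<^sup>2"
  shows "\<exists>g\<in>\<Omega>. \<forall>l\<in>\<Lambda>. f l g \<le> \<mu> l + d"
proof (rule ccontr)
  assume "\<not> ?thesis"
  then have *: "\<And>g. g \<in> \<Omega> \<Longrightarrow> \<exists>l\<in>\<Lambda>. d < f l g - \<mu> l" by force
  have "real (card \<Omega>) * d\<^sup>2 = (\<Sum>g\<in>\<Omega>. d\<^sup>2)" by simp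
  also have "\<dots> \<le> (\<Sum>g\<in>\<Omega>. \<Sum>l\<in>\<Lambda>. (f l g - \<mu> l)\<^sup>2)"
  proof (rule sum_mono)
    fix g assume "g \<in> \<Omega>"
    then obtain l where l: "l \<in> \<Lambda>" "d < f l g - \<mu> l" using * by blast
    then have "d\<^sup>2 \<le> (f l g - \<mu> l)\<^sup>2" using assms(4) by (intro power_mono) auto
    also have "\<dots> \<le> (\<Sum>l\<in>\<Lambda>. (f l g - \<mu> l)\<^sup>2)"
      using l assms(3) by (intro member_le_sum) auto
    finally show "d\<^sup>2 \<le> (\<Sum>l\<in>\<Lambda>. (f l g - \<mu> l)\<^sup>2)" .
  qed
  also have "\<dots> = (\<Sum>l\<in>\<Lambda>. \<Sum>g\<in>\<Omega>. (f l g - \<mu> l)\<^sup>2)" by (rule sum.swap)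
  also have "\<dots> \<le> (\<Sum>l\<in>\<Lambda>. card \<Omega> * R)" using assms(5) by (rule sum_mono)
  also have "\<dots> = card \<Omega> * (card \<Lambda> * R)" by simp
  also have "\<dots> < card \<Omega> * d\<^sup>2"
    using assms by (intro mult_strict_left_mono) (auto simp: card_gt_0_iff)
  finally show False by simp
qed

section \<open>Degree sums and the number of vertices of large degree\<close>

lemma handshake:
  assumes "finite V" "E \<subseteq> [V]\<^bsup>2\<^esup>"
  shows "(\<Sum>v\<in>V. card {e\<in>E. v \<in> e}) = 2 * card E"
proof -
  have fE: "finite E" using assms finite_imp_finite_nsets finite_subset by blast
  have "(\<Sum>v\<in>V. card {e\<in>E. v \<in> e}) = (\<Sum>v\<in>V. \<Sum>e\<in>E. of_bool (v \<in> e))"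
    using fE by (simp add: sum_of_bool_eq Int_def)
  also have "\<dots> = (\<Sum>e\<in>E. \<Sum>v\<in>V. of_bool (v \<in> e))" by (rule sum.swap)
  also have "\<dots> = (\<Sum>e\<in>E. 2)"
  proof (rule sum.cong[OF refl])
    fix e assume "e \<in> E"
    then have "e \<subseteq> V" "card e = 2" using assms(2) by (auto simp: nsets_def)
    then show "(\<Sum>v\<in>V. of_bool (v \<in> e)) = (2::nat)"
      using assms(1) by (simp add: sum_of_bool_eq Int_absorb1)
  qed
  finally show ?thesis by simp
qed

text \<open>Markov's inequality for degrees. The strict form later saves the one colour that would
  otherwise be missing for the vertices of large degree.\<close>

lemma card_high_degree_less:
  fixes t :: real
  assumes "finite V" "E \<subseteq> [V]\<^bsup>2\<^esup>" "{v\<in>V. t < card {e\<in>E. v \<in> e}} \<noteq> {}"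
  shows "t * card {v\<in>V. t < card {e\<in>E. v \<in> e}} < 2 * card E"
proof -
  have "t * card {v\<in>V. t < card {e\<in>E. v \<in> e}} = (\<Sum>v\<in>{v\<in>V. t < card {e\<in>E. v \<in> e}}. t)" by simp
  also have "\<dots> < (\<Sum>v\<in>{v\<in>V. t < card {e\<in>E. v \<in> e}}. real (card {e\<in>E. v \<in> e}))"
    using assms(1,3) by (intro sum_strict_mono) auto
  also have "\<dots> \<le> (\<Sum>v\<in>V. real (card {e\<in>E. v \<in> e}))"
    using assms(1) by (intro sum_mono2) auto
  also have "\<dots> = 2 * card E" using handshake[OF assms(1,2)] by (simp flip: of_nat_sum)
  finally show ?thesis .
qed

text \<open>In the bound, the first two terms estimate the mean number of edges in a line,
  \<open>d\<close> is the deviation, and the last term pays for the edges inside the set of vertices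
  of degree above \<eta>. The condition on \<open>d\<close> is what Chebyshev's inequality asks for
  (q + 1) q lines and variance at most 2 |E| \<eta>.\<close>

lemma (in conic_plane) ex_placement:
  fixes D \<eta> d :: real
  assumes V: "finite V" and E: "E \<subseteq> [V]\<^bsup>2\<^esup>"
    and deg: "\<And>v. v \<in> V \<Longrightarrow> card {e\<in>E. v \<in> e} \<le> D" and "0 \<le> D"
    and \<eta>: "0 < \<eta>" and d: "0 \<le> d" "real ((q + 1) * q) * (2 * card E * \<eta>) < d\<^sup>2"
  shows "\<exists>g \<in> V \<rightarrow> P. \<forall>c\<le>q. \<forall>k\<in>K. real (card {e\<in>E. \<forall>v\<in>e. \<phi> c (g v) = k})
           \<le> 2 * card E / q\<^sup>2 + 2 * D / q + d + (2 * card E / \<eta>)\<^sup>2"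
proof -
  let ?deg = "\<lambda>v. card {e\<in>E. v \<in> e}"
  define A where "A = {v\<in>V. \<eta> < ?deg v}"
  define B where "B = V - A"
  \<comment> \<open>Only edges with an end in \<open>B\<close> are weighed; edges inside
    \<open>A\<close> are paid for separately at the end.\<close>
  define w where "w a = real (card {e\<in>E. a \<in> e \<and> e \<inter> B \<noteq> {}})" for a
  define L where "L c k = {p\<in>P. \<phi> c p = k}" for c k
  have fE: "finite E" using V E finite_imp_finite_nsets finite_subset by blast
  have fin: "finite A" "finite B" using V by (auto simp: A_def B_def)
  have V_eq: "V = A \<union> B" and AB: "A \<inter> B = {}" by (auto simp: A_def B_def)
  have P: "P \<noteq> {}" using card_P q by auto
  have edge: "e \<subseteq> V" "card e = 2" "finite e" "card (e \<inter> A) + card (e \<inter> B) = 2" if "e \<in> E" for e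
  proof -
    show e: "e \<subseteq> V" "card e = 2" "finite e" using that E by (auto simp: nsets_def)
    have "e = (e \<inter> A) \<union> (e \<inter> B)" using e V_eq by auto
    then have "card e = card (e \<inter> A) + card (e \<inter> B)"
      by (metis card_Un_disjoint Int_Un_distrib AB e(3) finite_Int inf_assoc inf_bot_right inf_left_commute)
    then show "card (e \<inter> A) + card (e \<inter> B) = 2" using e by simp
  qed
  have w: "0 \<le> w a \<and> w a \<le> D" if "a \<in> A" for a
  proof -
    have "w a \<le> ?deg a" unfolding w_def using fE by (auto intro!: card_mono)
    also have "\<dots> \<le> D" using that deg by (auto simp: A_def)
    finally show ?thesis by (simp add: w_def)
  qed
  have C: "finite C" "C \<noteq> {}" using C_P finite_P finite_subset card_C q by auto
  \<comment> \<open>The few vertices of large degree would spoil concentration, so they are put on the conic by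
    hand; the remaining ones are placed uniformly at random.\<close>
  have "\<exists>h \<in> A \<rightarrow> C. \<forall>s\<in>C. sum w {a\<in>A. h a = s} \<le> sum w A / card C + D"
    by (rule balanced_partition) (use fin C w \<open>0 \<le> D\<close> in auto)
  then obtain h where h: "h \<in> A \<rightarrow> C" and hw: "\<And>s. s \<in> C \<Longrightarrow> sum w {a\<in>A. h a = s} \<le> sum w A / q + D"
    unfolding card_C by blast
  define E2 where "E2 = {e\<in>E. e \<inter> A = {}}"
  define E1 where "E1 = {e\<in>E. e \<inter> A \<noteq> {} \<and> e \<inter> B \<noteq> {}}"
  have card_E12: "real (card E1) + real (card E2) \<le> real (card E)"
  proof -
    have "card E1 + card E2 = card (E1 \<union> E2)"
      using fE by (intro card_Un_disjoint[symmetric]) (auto simp: E1_def E2_def)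
    also have "\<dots> \<le> card E" using fE by (intro card_mono) (auto simp: E1_def E2_def)
    finally show ?thesis by linarith
  qed
  have sum_w: "sum w A = card E1"
  proof -
    have "sum w A = (\<Sum>a\<in>A. \<Sum>e\<in>E1. of_bool (a \<in> e))"
    proof (rule sum.cong[OF refl])
      fix a assume "a \<in> A"
      then have "{e\<in>E. a \<in> e \<and> e \<inter> B \<noteq> {}} = E1 \<inter> {e. a \<in> e}" by (auto simp: E1_def)
      then show "w a = (\<Sum>e\<in>E1. of_bool (a \<in> e))"
        using fE by (simp add: w_def sum_of_bool_eq E1_def)
    qed
    also have "\<dots> = (\<Sum>e\<in>E1. \<Sum>a\<in>A. of_bool (a \<in> e))" by (rule sum.swap)
    also have "\<dots> = (\<Sum>e\<in>E1. 1)"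
    proof (rule sum.cong[OF refl])
      fix e assume e: "e \<in> E1"
      then have "card (e \<inter> A) \<noteq> 0" "card (e \<inter> B) \<noteq> 0" "card (e \<inter> A) + card (e \<inter> B) = 2"
        using fin edge by (auto simp: E1_def)
      then have "card (A \<inter> e) = 1" by (simp add: Int_commute)
      then show "(\<Sum>a\<in>A. of_bool (a \<in> e)) = (1::real)" using fin by (simp add: sum_of_bool_eq)
    qed
    finally show ?thesis by simp
  qed
  \<comment> \<open>A line meets the conic in at most two points, and each of these carries at most
    the average weight plus \<open>D\<close>.\<close>
  have sum_w_line: "sum w {a\<in>A. h a \<in> L c k} \<le> 2 * (sum w A / q + D)" if "c \<le> q" for c k
  proof -
    let ?M = "{p\<in>C. \<phi> c p = k}"
    have "{a\<in>A. h a \<in> L c k} = (\<Union>s\<in>?M. {a\<in>A. h a = s})"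
      using h C_P by (auto simp: L_def)
    then have "sum w {a\<in>A. h a \<in> L c k} = (\<Sum>s\<in>?M. sum w {a\<in>A. h a = s})"
      by (simp only:) (rule sum.UNION_disjoint, use fin C in auto)
    also have "\<dots> \<le> (\<Sum>s\<in>?M. sum w A / q + D)" using hw by (intro sum_mono) auto
    also have "\<dots> = card ?M * (sum w A / q + D)" by simp
    also have "\<dots> \<le> 2 * (sum w A / q + D)"
      using card_line_C[OF that, of k] w \<open>0 \<le> D\<close>
      by (intro mult_right_mono add_nonneg_nonneg divide_nonneg_nonneg sum_nonneg) auto
    finally show ?thesis .
  qed
  \<comment> \<open>Once \<open>h\<close> is fixed, these are the edges with a random end that can
    still fall into the line; an edge does so if its part in \<open>B\<close> lands there.
    Accordingly \<mu> is the expected number of such edges.\<close>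
  define F where "F c k = {e\<in>E. e \<inter> B \<noteq> {} \<and> h ` (e \<inter> A) \<subseteq> L c k}" for c k
  define \<mu> where "\<mu> c k = (\<Sum>e\<in>F c k. (real (card (L c k)) / real (card P)) ^ card (e \<inter> B))" for c k
  have fF: "finite (F c k)" for c k using fE by (simp add: F_def)
  have \<mu>: "\<mu> c k \<le> 2 * card E / q\<^sup>2 + 2 * D / q" if c: "c \<le> q" for c k
  proof -
    define \<rho> where "\<rho> = real (card (L c k)) / real (card P)"
    \<comment> \<open>A line has at most q of the q * q points, so a random vertex hits it with
      probability at most 1 / q.\<close>
    have "real (card (L c k)) \<le> q" using card_line[OF c] by (simp add: L_def)
    then have \<rho>: "0 \<le> \<rho>" "\<rho> \<le> 1 / q"
      using q by (auto simp: \<rho>_def card_P power2_eq_square field_simps)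
    let ?F2 = "F c k \<inter> E2" and ?F1 = "F c k \<inter> E1"
    have "F c k = ?F2 \<union> ?F1" by (auto simp: F_def E1_def E2_def)
    then have "\<mu> c k = (\<Sum>e\<in>?F2 \<union> ?F1. \<rho> ^ card (e \<inter> B))" unfolding \<mu>_def \<rho>_def by simp
    also have "\<dots> = (\<Sum>e\<in>?F2. \<rho> ^ card (e \<inter> B)) + (\<Sum>e\<in>?F1. \<rho> ^ card (e \<inter> B))"
      using fF by (intro sum.union_disjoint) (auto simp: E1_def E2_def)
    also have "(\<Sum>e\<in>?F2. \<rho> ^ card (e \<inter> B)) \<le> (\<Sum>e\<in>?F2. (1 / q)\<^sup>2)"
    proof (rule sum_mono)
      fix e assume "e \<in> ?F2"
      then have "card (e \<inter> B) = 2" using edge(4)[of e] by (simp add: E2_def)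
      then show "\<rho> ^ card (e \<inter> B) \<le> (1 / q)\<^sup>2" using \<rho> by (simp only: power_mono)
    qed
    also have "\<dots> = card ?F2 / q\<^sup>2" by (simp add: power_divide)
    also have "\<dots> \<le> card E2 / q\<^sup>2" using fE by (intro divide_right_mono of_nat_mono card_mono) (auto simp: E2_def)
    also have "(\<Sum>e\<in>?F1. \<rho> ^ card (e \<inter> B)) \<le> (\<Sum>e\<in>?F1. 1 / q)"
    proof (rule sum_mono)
      fix e assume e: "e \<in> ?F1"
      then have "card (e \<inter> A) \<noteq> 0" "card (e \<inter> B) \<noteq> 0" "card (e \<inter> A) + card (e \<inter> B) = 2"
        using fin edge by (auto simp: E1_def)
      then have "card (e \<inter> B) = 1" by simp
      then show "\<rho> ^ card (e \<inter> B) \<le> 1 / q" using \<rho> by simp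
    qed
    also have "\<dots> = card ?F1 / q" by simp
    also have "real (card ?F1) \<le> sum w {a\<in>A. h a \<in> L c k}"
    proof -
      \<comment> \<open>A mixed edge in \<open>F c k\<close> has its end in \<open>A\<close> placed
        on the line, so it is counted in the weight of that end.\<close>
      have "?F1 \<subseteq> (\<Union>a\<in>{a\<in>A. h a \<in> L c k}. {e\<in>E. a \<in> e \<and> e \<inter> B \<noteq> {}})"
        by (auto simp: F_def E1_def)
      then have "card ?F1 \<le> card (\<Union>a\<in>{a\<in>A. h a \<in> L c k}. {e\<in>E. a \<in> e \<and> e \<inter> B \<noteq> {}})"
        using fin fE by (intro card_mono) auto
      also have "\<dots> \<le> (\<Sum>a\<in>{a\<in>A. h a \<in> L c k}. card {e\<in>E. a \<in> e \<and> e \<inter> B \<noteq> {}})"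
        using fin by (intro card_UN_le) auto
      finally show ?thesis unfolding w_def by (simp flip: of_nat_sum)
    qed
    also have "\<dots> \<le> 2 * (card E1 / q + D)" using sum_w_line[OF c] sum_w by simp
    finally have "\<mu> c k \<le> card E2 / q\<^sup>2 + 2 * (card E1 / q + D) / q"
      by (simp add: divide_right_mono)
    \<comment> \<open>The factor 2 on \<open>E1\<close> comes from the two conic points on a line;
      granting it to \<open>E2\<close> as well gives the bound by 2 |E|.\<close>
    also have "\<dots> = (card E2 + 2 * card E1) / q\<^sup>2 + 2 * D / q"
      by (simp add: add_divide_distrib power2_eq_square)
    also have "\<dots> \<le> 2 * card E / q\<^sup>2 + 2 * D / q"
      using card_E12 by (intro add_right_mono divide_right_mono) auto
    finally show ?thesis .
  qed
  \<comment> \<open>Correlated edges share a vertex of \<open>B\<close>, so their pairs number at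
    most the sum of squared degrees over \<open>B\<close>. All these degrees are at most \<eta>, and
    the degree sum is at most 2 |E|.\<close>
  have pairs: "real (card {(e, f) \<in> F c k \<times> F c k. (e \<inter> B) \<inter> (f \<inter> B) \<noteq> {}}) \<le> 2 * card E * \<eta>" for c k
  proof -
    have "{(e, f) \<in> F c k \<times> F c k. (e \<inter> B) \<inter> (f \<inter> B) \<noteq> {}} \<subseteq> (\<Union>b\<in>B. {e\<in>E. b \<in> e} \<times> {e\<in>E. b \<in> e})"
      by (auto simp: F_def)
    then have "card {(e, f) \<in> F c k \<times> F c k. (e \<inter> B) \<inter> (f \<inter> B) \<noteq> {}}
        \<le> card (\<Union>b\<in>B. {e\<in>E. b \<in> e} \<times> {e\<in>E. b \<in> e})"
      using fin fE by (intro card_mono) auto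
    also have "\<dots> \<le> (\<Sum>b\<in>B. card ({e\<in>E. b \<in> e} \<times> {e\<in>E. b \<in> e}))"
      using fin by (intro card_UN_le) auto
    also have "\<dots> = (\<Sum>b\<in>B. ?deg b * ?deg b)" by (simp add: card_cartesian_product)
    finally have "real (card {(e, f) \<in> F c k \<times> F c k. (e \<inter> B) \<inter> (f \<inter> B) \<noteq> {}})
        \<le> (\<Sum>b\<in>B. real (?deg b) * real (?deg b))" by (simp flip: of_nat_mult of_nat_sum)
    also have "\<dots> \<le> (\<Sum>b\<in>B. \<eta> * real (?deg b))"
      by (intro sum_mono mult_right_mono) (auto simp: A_def B_def)
    also have "\<dots> \<le> (\<Sum>v\<in>V. \<eta> * real (?deg v))"
      using V \<eta> by (intro sum_mono2) (auto simp: B_def)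
    also have "\<dots> = \<eta> * real (\<Sum>v\<in>V. ?deg v)" by (simp add: sum_distrib_left)
    finally show ?thesis by (simp add: handshake[OF V E] mult_ac)
  qed
  let ?X = "\<lambda>(c, k) g. real (card {e\<in>F c k. g ` (e \<inter> B) \<subseteq> L c k})"
  have "\<exists>g \<in> B \<rightarrow>\<^sub>E P. \<forall>l\<in>{..q} \<times> K. ?X l g \<le> (case l of (c, k) \<Rightarrow> \<mu> c k) + d"
  proof (rule ex_small_deviations)
    show "finite (B \<rightarrow>\<^sub>E P)" using fin finite_P by (intro finite_PiE) auto
    show "(B \<rightarrow>\<^sub>E P) \<noteq> {}" using P by (simp add: PiE_eq_empty_iff)
    show "finite ({..q} \<times> K)" using finite_K by simp
    show "real (card ({..q} \<times> K)) * (2 * card E * \<eta>) < d\<^sup>2" using d(2) card_K by (simp add: card_cartesian_product)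
  next
    fix l assume "l \<in> {..q} \<times> K"
    obtain c k where l: "l = (c, k)" by fastforce
    have "(\<Sum>g\<in>B \<rightarrow>\<^sub>E P. (?X (c, k) g - \<mu> c k)\<^sup>2) \<le> real (card (B \<rightarrow>\<^sub>E P)) *
        real (card {(e, f) \<in> F c k \<times> F c k. (e \<inter> B) \<inter> (f \<inter> B) \<noteq> {}})"
      unfolding \<mu>_def prod.case by (rule second_moment) (use fin fF finite_P P in \<open>auto simp: L_def\<close>)
    also have "\<dots> \<le> real (card (B \<rightarrow>\<^sub>E P)) * (2 * card E * \<eta>)"
      using pairs by (intro mult_left_mono) auto
    finally show "(\<Sum>g\<in>B \<rightarrow>\<^sub>E P. (?X l g - (case l of (c, k) \<Rightarrow> \<mu> c k))\<^sup>2)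
        \<le> real (card (B \<rightarrow>\<^sub>E P)) * (2 * card E * \<eta>)" unfolding l by simp
  qed (use d in auto)
  then obtain g where g: "g \<in> B \<rightarrow>\<^sub>E P"
    and gX: "\<And>c k. c \<le> q \<Longrightarrow> k \<in> K \<Longrightarrow> card {e\<in>F c k. g ` (e \<inter> B) \<subseteq> L c k} \<le> \<mu> c k + d"
    by auto
  define g' where "g' v = (if v \<in> A then h v else g v)" for v
  have g': "g' \<in> V \<rightarrow> P" using h g C_P V_eq by (auto simp: g'_def PiE_iff Pi_iff subset_iff)
  have "real (card {e\<in>E. \<forall>v\<in>e. \<phi> c (g' v) = k}) \<le> 2 * card E / q\<^sup>2 + 2 * D / q + d + (2 * card E / \<eta>)\<^sup>2"
    if c: "c \<le> q" and k: "k \<in> K" for c k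
  proof -
    let ?Y = "{e\<in>F c k. g ` (e \<inter> B) \<subseteq> L c k}"
    \<comment> \<open>Edges inside \<open>A\<close> escape the random count. They are bounded by all
      pairs in \<open>A\<close>, where |A| is at most 2 |E| / \<eta> by Markov's inequality.\<close>
    have "{e\<in>E. \<forall>v\<in>e. \<phi> c (g' v) = k} \<subseteq> ?Y \<union> [A]\<^bsup>2\<^esup>"
    proof clarify
      fix e assume e: "e \<in> E" "\<forall>v\<in>e. \<phi> c (g' v) = k" "e \<notin> [A]\<^bsup>2\<^esup>"
      then have "e \<inter> B \<noteq> {}" using edge[OF e(1)] V_eq by (auto simp: nsets_def)
      moreover have "g' ` e \<subseteq> L c k" using e(2) g' edge(1)[OF e(1)] by (auto simp: L_def)
      moreover have "h ` (e \<inter> A) \<subseteq> g' ` e" "g ` (e \<inter> B) \<subseteq> g' ` e"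
        using AB by (auto simp: g'_def image_iff)
      ultimately have "h ` (e \<inter> A) \<subseteq> L c k" "g ` (e \<inter> B) \<subseteq> L c k" "e \<inter> B \<noteq> {}"
        by (meson subset_trans)+
      then show "e \<in> F c k \<and> g ` (e \<inter> B) \<subseteq> L c k" using e(1) by (simp add: F_def)
    qed
    then have "card {e\<in>E. \<forall>v\<in>e. \<phi> c (g' v) = k} \<le> card (?Y \<union> [A]\<^bsup>2\<^esup>)"
      using fF fin by (intro card_mono) (auto simp: finite_imp_finite_nsets)
    also have "\<dots> \<le> card ?Y + card ([A]\<^bsup>2\<^esup>)" by (rule card_Un_le)
    also have "card ([A]\<^bsup>2\<^esup>) \<le> (card A)\<^sup>2"
      unfolding card_nsets choose_two power2_eq_square
      by (metis div_le_dividend le_trans mult_le_mono2 diff_le_self)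
    finally have "real (card {e\<in>E. \<forall>v\<in>e. \<phi> c (g' v) = k}) \<le> real (card ?Y) + (real (card A))\<^sup>2"
      by (simp flip: of_nat_power of_nat_add)
    moreover have "\<eta> * card A \<le> 2 * card E"
      using card_high_degree_less[OF V E, of \<eta>] unfolding A_def[symmetric] by (cases "A = {}") auto
    then have "real (card A) \<le> 2 * card E / \<eta>" using \<eta> by (simp add: field_simps)
    then have "(real (card A))\<^sup>2 \<le> (2 * card E / \<eta>)\<^sup>2" by (intro power_mono) auto
    ultimately show ?thesis using gX[OF c k] \<mu>[OF c, of k] by linarith
  qed
  with g' show ?thesis by blast
qed

subsection \<open>Graphs\<close>

text \<open>A monochromatic clique on as many vertices as \<open>H\<close> contains a copy of
  \<open>H\<close> under any bijection of the vertices. This ensures that the \<open>LEAST\<close>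
  in \<open>size_ramsey\<close> is attained.\<close>

lemma ex_ramsey_for:
  assumes "simple_graph H"
  shows "\<exists>G :: nat sgraph. simple_graph G \<and> ramsey_for r G H"
proof -
  let ?n = "card (verts H)"
  obtain N :: nat where N: "partn_lst {..<N} (replicate r ?n) 2" using ramsey_full by blast
  define G :: "nat sgraph" where "G = \<lparr>verts = {..<N}, edges = [{..<N}]\<^bsup>2\<^esup>\<rparr>"
  have G: "simple_graph G" by (simp add: G_def simple_graph_def)
  have "ramsey_for r G H"
    unfolding ramsey_for_def
  proof
    fix c assume "c \<in> edges G \<rightarrow> {..<r}"
    then have "\<exists>i<r. monochromatic {..<N} (replicate r ?n ! i) 2 c i"
      using N by (auto simp: partn_lst_def G_def)
    then obtain i where i: "i < r" "monochromatic {..<N} ?n 2 c i" by auto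
    then obtain W where W: "W \<in> [{..<N}]\<^bsup>?n\<^esup>" "c ` [W]\<^bsup>2\<^esup> \<subseteq> {i}"
      unfolding monochromatic_def by blast
    have W': "W \<subseteq> {..<N}" "finite W" "card W = ?n" using W(1) by (auto simp: nsets_def)
    obtain f where f: "bij_betw f (verts H) W"
      using finite_same_card_bij[of "verts H" W] W' assms by (auto simp: simple_graph_def)
    define K where "K = \<lparr>verts = W, edges = (\<lambda>e. f ` e) ` edges H\<rparr>"
    have "f ` e \<in> [W]\<^bsup>2\<^esup>" if "e \<in> edges H" for e
    proof -
      have e: "e \<subseteq> verts H" "finite e" "card e = 2"
        using that assms by (auto simp: simple_graph_def nsets_def)
      have "card (f ` e) = card e"
        using f e(1) by (intro card_image) (auto simp: bij_betw_def inj_on_subset)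
      then show ?thesis using e f by (auto simp: nsets_def bij_betw_def)
    qed
    then have K: "edges K \<subseteq> [W]\<^bsup>2\<^esup>" by (auto simp: K_def)
    have "subgraph K G"
      using G K W' nsets_mono[OF W'(1), of 2] by (auto simp: subgraph_def simple_graph_def K_def G_def)
    moreover have "isomorphic H K" using f by (auto simp: isomorphic_def K_def)
    moreover have "\<forall>e\<in>edges K. c e = i" using K W(2) by auto
    ultimately show "\<exists>K. subgraph K G \<and> isomorphic H K \<and> (\<exists>i<r. \<forall>e\<in>edges K. c e = i)"
      using i(1) by blast
  qed
  with G show ?thesis by blast
qed

section \<open>Isomorphism invariance, stars and monochromatic copies\<close>

lemma isomorphic_trans:
  assumes "isomorphic G H" "isomorphic H K"
  shows "isomorphic G K"
proof -
  from assms(1) obtain f where f: "bij_betw f (verts G) (verts H)" "edges H = (\<lambda>e. f ` e) ` edges G"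
    unfolding isomorphic_def by blast
  from assms(2) obtain g where g: "bij_betw g (verts H) (verts K)" "edges K = (\<lambda>e. g ` e) ` edges H"
    unfolding isomorphic_def by blast
  have "bij_betw (g \<circ> f) (verts G) (verts K)" using bij_betw_trans[OF f(1) g(1)] .
  moreover have "edges K = (\<lambda>e. (g \<circ> f) ` e) ` edges G"
    unfolding f(2) g(2) by (simp add: image_image)
  ultimately show ?thesis unfolding isomorphic_def by blast
qed

lemma isomorphic_card_edges:
  assumes "simple_graph H" "isomorphic H K"
  shows "card (edges K) = card (edges H)"
proof -
  obtain f where f: "bij_betw f (verts H) (verts K)" "edges K = (\<lambda>e. f ` e) ` edges H"
    using assms(2) by (auto simp: isomorphic_def)
  have "edges H \<subseteq> Pow (verts H)" using assms(1) by (auto simp: simple_graph_def nsets_def)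
  moreover have "inj_on (\<lambda>e. f ` e) (Pow (verts H))"
    using f(1) by (intro inj_on_image_Pow) (simp add: bij_betw_def)
  ultimately have "inj_on (\<lambda>e. f ` e) (edges H)" by (meson inj_on_subset)
  then show ?thesis unfolding f(2) by (rule card_image)
qed

lemma isomorphic_connected:
  assumes "connected_graph H" "isomorphic H K"
  shows "connected_graph K"
proof -
  obtain f where f: "bij_betw f (verts H) (verts K)" "edges K = (\<lambda>e. f ` e) ` edges H"
    using assms(2) by (auto simp: isomorphic_def)
  have step: "(f u, f v) \<in> {(x, y). {x, y} \<in> edges K}\<^sup>*" if "(u, v) \<in> {(x, y). {x, y} \<in> edges H}\<^sup>*" for u v
    using that
  proof induction
    case (step y z)
    then have "{f y, f z} \<in> edges K" unfolding f(2) by (intro image_eqI[of _ _ "{y, z}"]) auto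
    then show ?case using step.IH by (auto intro: rtrancl_into_rtrancl)
  qed simp
  have V: "verts K = f ` verts H" using f(1) by (simp add: bij_betw_def)
  show ?thesis
    unfolding connected_graph_def V
    using assms(1) step by (simp add: connected_graph_def)
qed

lemma connected_edges_through_vertex_is_star:
  assumes K: "simple_graph K" "connected_graph K" and ne: "edges K \<noteq> {}"
    and v: "\<And>e. e \<in> edges K \<Longrightarrow> v \<in> e"
  shows "is_star K"
proof -
  have edge: "e \<subseteq> verts K" "card e = 2" if "e \<in> edges K" for e
    using that K(1) by (auto simp: simple_graph_def nsets_def)
  obtain e where e: "e \<in> edges K" using ne by blast
  then have vK: "v \<in> verts K" using v edge by blast
  define N where "N = verts K - {v}"
  have fN: "finite N" using K(1) by (simp add: N_def simple_graph_def)
  have nbr: "{v, u} \<in> edges K" if "u \<in> N" for u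
  proof -
    have "(u, v) \<in> {(x, y). {x, y} \<in> edges K}\<^sup>*" "u \<noteq> v"
      using that vK K(2) by (auto simp: N_def connected_graph_def)
    \<comment> \<open>The first edge on a path from \<open>u\<close> to \<open>v\<close> must
      contain \<open>v\<close>, so it is the edge {v, u}.\<close>
    then obtain y where "{u, y} \<in> edges K" by (auto elim: converse_rtranclE)
    with v[OF this] \<open>u \<noteq> v\<close> show ?thesis by (auto simp: insert_commute)
  qed
  have edges: "edges K = (\<lambda>u. {v, u}) ` N"
  proof
    show "(\<lambda>u. {v, u}) ` N \<subseteq> edges K" using nbr by auto
    show "edges K \<subseteq> (\<lambda>u. {v, u}) ` N"
    proof
      fix e assume e: "e \<in> edges K"
      then obtain u where "e = {v, u}" "u \<noteq> v"
        using v[OF e] edge(2)[OF e] by (auto simp: card_2_iff)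
      then show "e \<in> (\<lambda>u. {v, u}) ` N" using edge(1)[OF e] by (auto simp: N_def)
    qed
  qed
  let ?k = "card N"
  have "?k \<ge> 1" using ne edges fN by (auto simp: Suc_le_eq card_gt_0_iff)
  obtain h where h: "bij_betw h N {1..?k}"
    using finite_same_card_bij[OF fN, of "{1..?k}"] by auto
  define f where "f u = (if u = v then 0 else h u)" for u
  have fh: "f u = h u" if "u \<in> N" for u using that by (auto simp: f_def N_def)
  have "bij_betw f ({v} \<union> N) ({0} \<union> {1..?k})"
  proof (rule bij_betw_combine)
    show "bij_betw f {v} {0}" by (simp add: f_def bij_betw_def)
    show "bij_betw f N {1..?k}" using h bij_betw_cong[of N f h] fh by simp
  qed auto
  moreover have "{v} \<union> N = verts K" using vK by (auto simp: N_def)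
  moreover have "{0} \<union> {1..?k} = {0..?k}" by auto
  ultimately have "bij_betw f (verts K) {0..?k}" by simp
  moreover have "{{0, i} |i. i \<in> {1..?k}} = (\<lambda>e. f ` e) ` edges K"
  proof -
    have "{{0, i} |i. i \<in> {1..?k}} = (\<lambda>i. {0, i}) ` h ` N"
      using h by (auto simp: bij_betw_def)
    also have "\<dots> = (\<lambda>u. {0, f u}) ` N" using fh by (auto simp: image_image)
    also have "\<dots> = (\<lambda>e. f ` e) ` edges K" unfolding edges image_image by (intro image_cong) (auto simp: f_def)
    finally show ?thesis .
  qed
  ultimately have "isomorphic K (star_graph ?k)" by (auto simp: isomorphic_def star_graph_def)
  then show ?thesis using \<open>?k \<ge> 1\<close> by (auto simp: is_star_def)
qed

lemma connected_function_constant: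
  assumes "connected_graph K" and "\<And>u v. {u, v} \<in> edges K \<Longrightarrow> \<psi> u = \<psi> v"
    and "u \<in> verts K" "v \<in> verts K"
  shows "\<psi> u = \<psi> v"
proof -
  have "(u, v) \<in> {(x, y). {x, y} \<in> edges K}\<^sup>*" using assms by (simp add: connected_graph_def)
  then show ?thesis by induction (use assms(2) in auto)
qed

text \<open>A monochromatic copy of \<open>H\<close> is connected. If all edges of its colour pass
  through one vertex, it is a star; if \<psi> is constant along the edges of its colour, the copy
  lies in a single fibre of \<psi>, which has too few edges of that colour.\<close>

lemma not_ramsey_forI:
  assumes H: "simple_graph H" "connected_graph H" "\<not> is_star H" "edges H \<noteq> {}"
    and c: "c \<in> edges G \<rightarrow> {..<r}"
    and stars_or_small: "\<And>i. i < r \<Longrightarrow>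
      (\<exists>v. \<forall>e\<in>edges G. c e = i \<longrightarrow> v \<in> e) \<or>
      (\<exists>\<psi>. (\<forall>u v. {u, v} \<in> edges G \<and> c {u, v} = i \<longrightarrow> \<psi> u = \<psi> v) \<and>
           (\<forall>x\<in>verts G. card {e\<in>edges G. c e = i \<and> (\<forall>v\<in>e. \<psi> v = \<psi> x)} < card (edges H)))"
  shows "\<not> ramsey_for r G H"
proof
  assume "ramsey_for r G H"
  then obtain K i where K: "subgraph K G" "isomorphic H K" and i: "i < r" "\<forall>e\<in>edges K. c e = i"
    using c unfolding ramsey_for_def by blast
  have sK: "simple_graph K" and G: "simple_graph G" and KG: "edges K \<subseteq> edges G" "verts K \<subseteq> verts G"
    using K(1) by (auto simp: subgraph_def)
  have cK: "connected_graph K" using isomorphic_connected[OF H(2) K(2)] .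
  have card_K: "card (edges K) = card (edges H)" using isomorphic_card_edges[OF H(1) K(2)] .
  have neK: "edges K \<noteq> {}" using K(2) H(4) by (auto simp: isomorphic_def)
  from stars_or_small[OF i(1)] show False
  proof (elim disjE exE conjE)
    fix v assume "\<forall>e\<in>edges G. c e = i \<longrightarrow> v \<in> e"
    then have "is_star K"
      using KG i(2) by (intro connected_edges_through_vertex_is_star[OF sK cK neK]) auto
    then have "is_star H" using isomorphic_trans[OF K(2)] by (auto simp: is_star_def)
    then show False using H(3) by simp
  next
    fix \<psi> assume \<psi>: "\<forall>u v. {u, v} \<in> edges G \<and> c {u, v} = i \<longrightarrow> \<psi> u = \<psi> v"
      and small: "\<forall>x\<in>verts G. card {e\<in>edges G. c e = i \<and> (\<forall>v\<in>e. \<psi> v = \<psi> x)} < card (edges H)"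
    obtain x where x: "x \<in> verts K" using cK by (auto simp: connected_graph_def)
    have const: "\<psi> v = \<psi> x" if "v \<in> verts K" for v
      using \<psi> KG i(2) by (intro connected_function_constant[OF cK _ that x]) auto
    have "edges K \<subseteq> {e\<in>edges G. c e = i \<and> (\<forall>v\<in>e. \<psi> v = \<psi> x)}"
    proof
      fix e assume e: "e \<in> edges K"
      then have "e \<subseteq> verts K" using sK by (auto simp: simple_graph_def nsets_def)
      then show "e \<in> {e\<in>edges G. c e = i \<and> (\<forall>v\<in>e. \<psi> v = \<psi> x)}"
        using e KG(1) i(2) const by blast
    qed
    moreover have "finite (edges G)"
      using G finite_subset finite_imp_finite_nsets by (auto simp: simple_graph_def)
    ultimately have "card (edges K) \<le> card {e\<in>edges G. c e = i \<and> (\<forall>v\<in>e. \<psi> v = \<psi> x)}"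
      by (intro card_mono) auto
    then show False using small x KG(2) card_K by fastforce
  qed
qed

subsection \<open>The colouring\<close>

text \<open>The constant 72 enters here: with \<open>r \<le> 4 q \<le> 2 r\<close>, the first two terms are at most
  \<open>4/9 m\<close> and \<open>8/27 m\<close>, which leaves room for the deviation \<open>m / 5\<close> and the edges between vertices
  of large degree.\<close>

lemma numeric_bound:
  fixes r q e m :: real
  assumes r: "0 < r" "2 * q \<le> r" "r \<le> 4 * q" and m: "0 < m" "r ^ 12 \<le> m"
    and e: "0 \<le> e" "e \<le> r\<^sup>2 / 72 * m"
  shows "2 * e / q\<^sup>2 + 2 * (2 * e / (r - q)) / q + m / 5 + (2 * e / (m / r ^ 4))\<^sup>2 < m"
proof -
  have q: "0 < q" "0 < r - q" using r by auto
  have "2 * e / q\<^sup>2 \<le> 4 / 9 * m"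
  proof -
    have "2 * e \<le> r\<^sup>2 / 36 * m" using e by simp
    also have "\<dots> \<le> (4 * q)\<^sup>2 / 36 * m"
      using r m by (intro mult_right_mono divide_right_mono power_mono) auto
    finally show ?thesis using q by (simp add: field_simps power2_eq_square)
  qed
  moreover have "2 * (2 * e / (r - q)) / q \<le> 8 / 27 * m"
  proof -
    \<comment> \<open>For q between r / 4 and r / 2 the product (r - q) q is smallest at q = r / 4,
      where it equals 3/16 of the square of r. The two factors express this.\<close>
    have "0 \<le> (4 * q - r) * (3 * r - 4 * q)" using r by (intro mult_nonneg_nonneg) auto
    then have "r\<^sup>2 \<le> 16 / 3 * ((r - q) * q)" by (simp add: algebra_simps power2_eq_square)
    then have "r\<^sup>2 / 72 * m \<le> 16 / 3 * ((r - q) * q) / 72 * m"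
      using m by (intro mult_right_mono divide_right_mono) auto
    then have "4 * e \<le> 8 / 27 * m * ((r - q) * q)" using e by (simp add: algebra_simps)
    then show ?thesis using q by (simp add: pos_divide_le_eq mult_ac)
  qed
  moreover have "(2 * e / (m / r ^ 4))\<^sup>2 \<le> m / 1296"
  proof -
    have "2 * e / (m / r ^ 4) = 2 * e * r ^ 4 / m" by simp
    also have "\<dots> \<le> r ^ 6 / 36"
    proof -
      have "2 * e * r ^ 4 \<le> (r\<^sup>2 / 36 * m) * r ^ 4" using e by (intro mult_right_mono) auto
      also have "\<dots> = r ^ 6 / 36 * m" by (simp add: power_eq_if)
      finally show ?thesis using m by (simp add: pos_divide_le_eq)
    qed
    finally have "(2 * e / (m / r ^ 4))\<^sup>2 \<le> (r ^ 6 / 36)\<^sup>2"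
      using e m r by (intro power_mono) auto
    \<comment> \<open>This is where the threshold \<open>r ^ 12\<close> for \<open>m\<close> comes
      from.\<close>
    also have "\<dots> = r ^ 12 / 1296" by (simp add: power_divide flip: power_mult)
    finally show ?thesis using m by simp
  qed
  ultimately show ?thesis using m by linarith
qed

text \<open>This is the Chebyshev condition of the placement for \<eta> = m / r^4 and deviation m /
  5. As q + 1 \<le> 2 q \<le> r, the left side is at most the square of m / 6.\<close>

lemma numeric_bound_deviation:
  fixes r q e m :: real
  assumes r: "0 < r" "1 \<le> q" "2 * q \<le> r" and m: "0 < m"
    and e: "0 \<le> e" "e \<le> r\<^sup>2 / 72 * m"
  shows "(q + 1) * q * (2 * e * (m / r ^ 4)) < (m / 5)\<^sup>2"
proof -
  have "(q + 1) * q \<le> r * r" using r by (intro mult_mono) auto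
  moreover have "2 * e * (m / r ^ 4) \<le> (r\<^sup>2 / 36 * m) * (m / r ^ 4)"
    using r m e by (intro mult_right_mono) auto
  ultimately have "(q + 1) * q * (2 * e * (m / r ^ 4)) \<le> (r * r) * ((r\<^sup>2 / 36 * m) * (m / r ^ 4))"
    by (rule mult_mono) (use r m e in auto)
  also have "\<dots> = m\<^sup>2 / 36" using r by (simp add: power_eq_if)
  also have "\<dots> < (m / 5)\<^sup>2" using m by (simp add: power_divide)
  finally show ?thesis .
qed

text \<open>Colours 0 to q serve the parallel classes, and colours q + 1 to r - 1 are private to the
  vertices of degree above \<open>D\<close>.\<close>

lemma not_ramsey_for_sparse:
  assumes G: "simple_graph G" and r: "4 \<le> r"
    and H: "simple_graph H" "connected_graph H" "\<not> is_star H" "card (edges H) = m" and m: "r ^ 12 \<le> m"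
    and e: "card (edges G) \<le> (real r)\<^sup>2 / 72 * real m"
  shows "\<not> ramsey_for r G H"
proof -
  have m0: "m > 0" using r m by (metis gr0I le_zero_eq not_numeral_le_zero power_eq_0_iff)
  obtain n where n: "2 ^ n \<le> r" "r < 2 ^ (n + 1)" using ex_power_ivl1[of 2 r] r by auto
  have "n > 1"
  proof (rule ccontr)
    assume "\<not> n > 1"
    then have "(2::nat) ^ (n + 1) \<le> 2 ^ 2" by (intro power_increasing) auto
    then show False using n r by simp
  qed
  \<comment> \<open>One power below the largest power of two up to \<open>r\<close>; as r \<ge> 4,
    the exponent is still positive.\<close>
  define q :: nat where "q = 2 ^ (n - 1)"
  have "2 * q = 2 ^ n" using \<open>n > 1\<close> by (simp add: q_def flip: power_Suc)
  then have qr: "2 * q \<le> r" "r \<le> 4 * q" using n by auto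
  obtain P K C and \<phi> :: "nat \<Rightarrow> bit alg_closure \<times> bit alg_closure \<Rightarrow> bit alg_closure"
    where plane: "conic_plane q P K \<phi> C"
  proof -
    have "1 \<le> n - 1" using \<open>n > 1\<close> by simp
    then show ?thesis using ex_conic_plane that unfolding q_def by blast
  qed
  interpret conic_plane q P K \<phi> C by (rule plane)
  define V E where "V = verts G" and "E = edges G"
  have V: "finite V" "E \<subseteq> [V]\<^bsup>2\<^esup>" using G by (auto simp: simple_graph_def V_def E_def)
  have fE: "finite E" using V finite_imp_finite_nsets finite_subset by blast
  have edge: "e \<subseteq> V" "card e = 2" if "e \<in> E" for e using V(2) that by (auto simp: nsets_def)
  \<comment> \<open>With this threshold at most r - q - 1 vertices have larger degree, exactly the
    number of colours left after the q + 1 parallel classes.\<close>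
  define D where "D = 2 * real (card E) / (real r - real q)"
  define A where "A = {v\<in>V. D < card {e\<in>E. v \<in> e}}"
  have rq: "0 < real r - real q" using qr r by linarith
  have "card A < r - q"
  proof (cases "A = {}")
    case True
    then show ?thesis using qr r by simp
  next
    case False
    then have *: "D * card A < 2 * card E"
      using card_high_degree_less[OF V, of D] by (simp add: A_def)
    then have "card E > 0" by (cases "card E = 0") (auto simp: D_def)
    moreover have "2 * real (card E) * card A < 2 * real (card E) * (real r - real q)"
      using * rq by (simp add: D_def pos_divide_less_eq)
    ultimately have "real (card A) < real r - real q" by (simp add: mult_less_cancel_left_pos)
    then show ?thesis by linarith
  qed
  then have "card A \<le> card {q + 1..<r}" by simp
  moreover have fA: "finite A" using V by (simp add: A_def)
  ultimately obtain a where a: "a ` A \<subseteq> {q + 1..<r}" "inj_on a A"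
    using inj_on_iff_card_le[of A "{q + 1..<r}"] by blast
  define E' where "E' = {e\<in>E. e \<inter> A = {}}"
  have E': "E' \<subseteq> [V - A]\<^bsup>2\<^esup>" using V(2) by (auto simp: E'_def nsets_def)
  have card_E': "card E' \<le> card E" using fE by (auto simp: E'_def intro: card_mono)
  have deg: "card {e\<in>E'. v \<in> e} \<le> D" if "v \<in> V - A" for v
  proof -
    have "card {e\<in>E'. v \<in> e} \<le> card {e\<in>E. v \<in> e}" using fE by (auto simp: E'_def intro!: card_mono)
    then show ?thesis using that by (auto simp: A_def)
  qed
  have e: "real (card E) \<le> (real r)\<^sup>2 / 72 * real m" using e by (simp add: E_def)
  have e': "real (card E') \<le> (real r)\<^sup>2 / 72 * real m" using e card_E' by linarith
  have "\<exists>g \<in> V - A \<rightarrow> P. \<forall>c\<le>q. \<forall>k\<in>K. real (card {e\<in>E'. \<forall>v\<in>e. \<phi> c (g v) = k})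
       \<le> 2 * card E' / q\<^sup>2 + 2 * D / q + real m / 5 + (2 * card E' / (real m / real r ^ 4))\<^sup>2"
  proof (rule ex_placement)
    show "real ((q + 1) * q) * (2 * card E' * (real m / real r ^ 4)) < (real m / 5)\<^sup>2"
    proof -
      have *: "real ((q + 1) * q) = (real q + 1) * real q" "real (2 * card E') = 2 * real (card E')"
        by (simp_all add: algebra_simps)
      show ?thesis
        unfolding * by (rule numeric_bound_deviation) (use q qr r m0 e' in auto)
    qed
  qed (use V E' deg rq m0 r in \<open>auto simp: D_def\<close>)
  then obtain g where g: "g \<in> V - A \<rightarrow> P" and
    g_le: "\<And>c k. c \<le> q \<Longrightarrow> k \<in> K \<Longrightarrow> real (card {e\<in>E'. \<forall>v\<in>e. \<phi> c (g v) = k})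
       \<le> 2 * card E' / q\<^sup>2 + 2 * D / q + real m / 5 + (2 * card E' / (real m / real r ^ 4))\<^sup>2"
    by blast
  have small: "card {e\<in>E'. \<forall>v\<in>e. \<phi> c (g v) = k} < m" if "c \<le> q" "k \<in> K" for c k
  proof -
    have "2 * card E' / q\<^sup>2 + 2 * D / q + real m / 5 + (2 * card E' / (real m / real r ^ 4))\<^sup>2
        \<le> 2 * card E / q\<^sup>2 + 2 * D / q + real m / 5 + (2 * card E / (real m / real r ^ 4))\<^sup>2"
      using card_E' by (intro add_mono divide_right_mono power_mono) auto
    also have "\<dots> < m"
      unfolding D_def of_nat_power of_nat_mult of_nat_numeral
      by (rule numeric_bound) (use qr r m m0 e in \<open>auto simp flip: of_nat_power\<close>)
    finally show ?thesis using g_le[OF that] by linarith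
  qed
  define line where "line e c \<longleftrightarrow> c \<le> q \<and> (\<forall>u\<in>e. \<forall>v\<in>e. \<phi> c (g u) = \<phi> c (g v))" for e c
  define col where "col e = (if e \<inter> A = {} then SOME c. line e c else a (SOME v. v \<in> e \<inter> A))" for e
  have line_col: "line e (col e)" if "e \<in> E'" for e
  proof -
    have e: "e \<inter> A = {}" "e \<subseteq> V" "card e = 2" using that edge by (auto simp: E'_def)
    then obtain u v where uv: "e = {u, v}" by (auto simp: card_2_iff)
    then have "g u \<in> P" "g v \<in> P" using e g by auto
    then obtain c where "c \<le> q" "\<phi> c (g u) = \<phi> c (g v)" using joined by blast
    then have "line e c" using uv by (auto simp: line_def)
    then show ?thesis using e(1) someI[of "line e"] by (simp add: col_def)
  qed
  have col_A: "\<exists>v\<in>e \<inter> A. col e = a v" if "e \<in> E" "e \<inter> A \<noteq> {}" for e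
    using that some_in_eq[of "e \<inter> A"] by (auto simp: col_def)
  have col_gt: "q < col e" if "e \<in> E" "e \<inter> A \<noteq> {}" for e
    using col_A[OF that] a(1) by fastforce
  show ?thesis
  proof (rule not_ramsey_forI[OF H(1,2,3), where c = col])
    show "edges H \<noteq> {}" using H(4) m0 by auto
    show "col \<in> edges G \<rightarrow> {..<r}"
    proof
      fix e assume "e \<in> edges G"
      then have "e \<in> E" by (simp add: E_def)
      show "col e \<in> {..<r}"
      proof (cases "e \<inter> A = {}")
        case True
        then show ?thesis using line_col[of e] \<open>e \<in> E\<close> qr r by (auto simp: E'_def line_def)
      next
        case False
        then show ?thesis using col_A[OF \<open>e \<in> E\<close>] a(1) by fastforce
      qed
    qed
    fix i assume "i < r"
    show "(\<exists>v. \<forall>e\<in>edges G. col e = i \<longrightarrow> v \<in> e) \<or>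
      (\<exists>\<psi> :: _ \<Rightarrow> bit alg_closure. (\<forall>u v. {u, v} \<in> edges G \<and> col {u, v} = i \<longrightarrow> \<psi> u = \<psi> v) \<and>
           (\<forall>x\<in>verts G. card {e\<in>edges G. col e = i \<and> (\<forall>v\<in>e. \<psi> v = \<psi> x)} < card (edges H)))"
    proof (cases "i \<le> q")
      case True
      have iE': "e \<in> E'" if "e \<in> E" "col e = i" for e
        using col_gt[OF that(1)] that True by (auto simp: E'_def)
      define \<psi> where "\<psi> v = \<phi> i (g v)" for v
      have const: "\<psi> u = \<psi> v" if "{u, v} \<in> E" "col {u, v} = i" for u v
      proof -
        have "line {u, v} i" using line_col[OF iE'[OF that]] unfolding that(2) .
        then show ?thesis unfolding line_def \<psi>_def by blast
      qed
      have few: "card {e\<in>E. col e = i \<and> (\<forall>v\<in>e. \<psi> v = \<psi> x)} < m" for x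
      proof -
        have sub: "{e\<in>E. col e = i \<and> (\<forall>v\<in>e. \<psi> v = \<psi> x)} \<subseteq> {e\<in>E'. \<forall>v\<in>e. \<phi> i (g v) = \<psi> x}"
          using iE' by (intro Collect_mono) (simp add: \<psi>_def)
        show ?thesis
        \<comment> \<open>The vertex \<open>x\<close> may lie in \<open>A\<close>, where nothing is
          known about \<open>g\<close>, so \<psi> may take a value there that names no line. No edge
          of \<open>E'\<close> has that value at its ends.\<close>
        proof (cases "\<psi> x \<in> K")
          case k: True
          have "card {e\<in>E. col e = i \<and> (\<forall>v\<in>e. \<psi> v = \<psi> x)} \<le> card {e\<in>E'. \<forall>v\<in>e. \<phi> i (g v) = \<psi> x}"
            using sub fE by (intro card_mono) (auto simp: E'_def)
          then show ?thesis using small[OF True k] by linarith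
        next
          case False
          have empty: "{e\<in>E'. \<forall>v\<in>e. \<phi> i (g v) = \<psi> x} = {}"
          proof (rule ccontr)
            assume "\<not> ?thesis"
            then obtain e where e: "e \<in> E'" "\<forall>v\<in>e. \<phi> i (g v) = \<psi> x" by blast
            then have "e \<noteq> {}" "e \<subseteq> V - A" using E' by (auto simp: nsets_def)
            then obtain v where "v \<in> e" "g v \<in> P" using g by blast
            then show False using \<phi>_K[OF True, of "g v"] e(2) False by simp
          qed
          show ?thesis using sub m0 unfolding empty subset_empty by (simp only: card.empty)
        qed
      qed
      show ?thesis
        using const few unfolding E_def[symmetric] H(4) by (intro disjI2 exI[of _ \<psi>]) simp
    next
      case False
      have "\<exists>v. \<forall>e\<in>E. col e = i \<longrightarrow> v \<in> e"
      proof (cases "i \<in> a ` A")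
        case True
        then obtain v where v: "v \<in> A" "i = a v" by blast
        \<comment> \<open>An edge with both ends in \<open>A\<close> takes the colour of one of
          them; injectivity of \<open>a\<close> shows that this end is \<open>v\<close>.\<close>
        have "v \<in> e" if e: "e \<in> E" "col e = i" for e
        proof -
          have "e \<inter> A \<noteq> {}" using line_col[of e] e False by (auto simp: E'_def line_def)
          then obtain u where "u \<in> e \<inter> A" "a u = a v" using col_A[OF e(1)] e(2) v by force
          then show ?thesis using v a(2) by (auto simp: inj_on_def)
        qed
        then show ?thesis by blast
      next
        case notin: False
        have "col e \<noteq> i" if "e \<in> E" for e
        proof (cases "e \<inter> A = {}")
          case True
          then show ?thesis using line_col[of e] that False by (auto simp: E'_def line_def)
        next
          case False
          then show ?thesis using col_A[OF that] notin by auto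
        qed
        then show ?thesis by blast
      qed
      then show ?thesis by (simp add: E_def)
    qed
  qed
qed

section \<open>Attaining the minimum, and the small values of \<open>r\<close>\<close>

lemma size_ramsey_attained:
  assumes "simple_graph H"
  shows "\<exists>G :: nat sgraph. simple_graph G \<and> card (edges G) = size_ramsey r H \<and> ramsey_for r G H"
proof -
  have "\<exists>n. \<exists>G :: nat sgraph. simple_graph G \<and> card (edges G) = n \<and> ramsey_for r G H"
    using ex_ramsey_for[OF assms] by blast
  then show ?thesis unfolding size_ramsey_def by (rule LeastI_ex)
qed

lemma ramsey_for_card_edges_le:
  assumes "ramsey_for r G H" "1 \<le> r" "simple_graph G" "simple_graph H"
  shows "card (edges H) \<le> card (edges G)"
proof -
  have "(\<lambda>_. 0) \<in> edges G \<rightarrow> {..<r}" using assms(2) by simp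
  then obtain K where K: "subgraph K G" "isomorphic H K"
    using assms(1) unfolding ramsey_for_def by blast
  have "finite (edges G)"
    using assms(3) finite_subset finite_imp_finite_nsets by (auto simp: simple_graph_def)
  then have "card (edges K) \<le> card (edges G)" using K(1) by (auto simp: subgraph_def intro: card_mono)
  then show ?thesis using isomorphic_card_edges[OF assms(4) K(2)] by simp
qed

theorem theorem1p1:
  fixes r :: nat
  assumes "r \<ge> 2"
  shows "\<exists>m0::nat. \<forall>(H :: 'a sgraph) (m::nat).
           simple_graph H \<and> connected_graph H \<and> card (edges H) = m \<and> m \<ge> m0 \<and> \<not> is_star H
           \<longrightarrow> real (size_ramsey r H) > (real r)\<^sup>2 / 72 * real m"
proof (intro exI[of _ "r ^ 12"] allI impI, elim conjE)
  fix H :: "'a sgraph" and m :: nat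
  assume H: "simple_graph H" "connected_graph H" "card (edges H) = m" "\<not> is_star H" and m: "r ^ 12 \<le> m"
  obtain G :: "nat sgraph" where G: "simple_graph G" "card (edges G) = size_ramsey r H" "ramsey_for r G H"
    using size_ramsey_attained[OF H(1)] by blast
  show "real (size_ramsey r H) > (real r)\<^sup>2 / 72 * real m"
  proof (cases "4 \<le> r")
    case True
    show ?thesis
    proof (rule ccontr)
      assume "\<not> ?thesis"
      then have "card (edges G) \<le> (real r)\<^sup>2 / 72 * real m" using G(2) by simp
      then show False using not_ramsey_for_sparse[OF G(1) True H(1,2,4,3) m] G(3) by blast
    qed
  next
    case False
    \<comment> \<open>For r \<le> 3 the factor is at most 1/8, so the trivial bound by the number of
      edges of \<open>H\<close> already suffices.\<close>
    have "(real r)\<^sup>2 \<le> 3\<^sup>2" using False by (intro power_mono) auto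
    then have "(real r)\<^sup>2 / 72 * real m \<le> 9 / 72 * real m"
      by (intro mult_right_mono divide_right_mono) auto
    moreover have "m > 0" using m assms by (metis gr0I le_zero_eq not_numeral_le_zero power_eq_0_iff)
    moreover have "m \<le> size_ramsey r H"
      using ramsey_for_card_edges_le[OF G(3) _ G(1) H(1)] assms G(2) H(3) by simp
    ultimately show ?thesis by linarith
  qed
qed

end
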